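(* Let $G$ be an infinite connected graph and let $\mathcal{P}$ be the property of being connected. (i) If $G$ satisfies (TI), then for any percolating everywhere subgraph $H$ of $G$, \[ p_{c,1}(G,H,\mathcal{P}) = p_{c,2}(G,H,\mathcal{P}). \] If moreover the number of connected components of $H$ is finite, then \[ p_{c,1}(G,H,\mathcal{P}) = p_{c,2}(G,H,\mathcal{P}) = 0. \] (ii) If $G$ does not satisfy (TI), then there is a percolating everywhere subgraph $H$ of $G$ such that \[ p_{c,1}(G,H,\mathcal{P}) = 0 \quad\text{and}\quad p_{c,2}(G,H,\mathcal{P}) = 1. \]
   Context: Graphs are locally finite, simple and non-oriented. (TI): for $A,B \subset V(G)$ let $E(A,B) := \{\{y,z\} \in E(G) : y \in A, z \in B\}$. $G$ satisfies (TI) if for all $A, B \subset V(G)$ with $V(G) = A \cup B$, $A \cap B = \emptyset$ and $|A| = |B| = +\infty$, the set $E(A,B)$ is infinite. A subgraph $H$ of $G$ is percolating everywhere if $V(H) = V(G)$ and every connected component of $H$ is infinite. Bernoulli bond percolation: for $p\in[0,1]$, $\mathbb{P}_p$ is the product measure on $\{0,1\}^{E(G)}$ under which each edge is open with probability $p$ independently. $C_x$ is the open cluster containing $x$. Enlargement: for a subgraph $H$ of $G$, $\mathcal{U}_p(H)$ is the random subgraph with $V(\mathcal{U}_p(H)) = \bigcup_{x \in V(H)} V(C_x)$ and $E(\mathcal{U}_p(H)) = E(H) \cup \bigcup_{x \in V(H)} E(C_x)$. $p_{c,1}(G,H,\mathcal{P}) := \inf\{p \in [0,1] : \mathbb{P}_p(\mathcal{U}_p(H)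 \in \mathcal{P}) > 0\}$ and $p_{c,2}(G,H,\mathcal{P}) := \inf\{p \in [0,1] : \mathbb{P}_p(\mathcal{U}_p(H) \in \mathcal{P}) = 1\}$, where $X \in \mathcal{P}$ means that the subgraph $X$ of $G$ satisfies $\mathcal{P}$. *)

theory Defs
  imports "HOL-Probability.Probability"
begin

record 'a ugraph =
  verts :: "'a set"
  edges :: "'a set set"

definition simple_graph :: "'a ugraph \<Rightarrow> bool" where
  "simple_graph G \<longleftrightarrow> (\<forall>e\<in>edges G. e \<subseteq> verts G \<and> card e = 2)"

definition locally_finite_graph :: "'a ugraph \<Rightarrow> bool" where
  "locally_finite_graph G \<longleftrightarrow> (\<forall>x\<in>verts G. finite {e \<in> edges G. x \<in> e})"

definition subgraph :: "'a ugraph \<Rightarrow> 'a ugraph \<Rightarrow> bool" where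
  "subgraph H G \<longleftrightarrow> simple_graph H \<and> verts H \<subseteq> verts G \<and> edges H \<subseteq> edges G"

text \<open>For vertices of a simple graph, this says that some finite path joins the two.\<close>

definition reachable :: "'a ugraph \<Rightarrow> 'a \<Rightarrow> 'a \<Rightarrow> bool" where
  "reachable G = (\<lambda>x y. {x, y} \<in> edges G)\<^sup>*\<^sup>*"

definition connected_graph :: "'a ugraph \<Rightarrow> bool" where
  "connected_graph G \<longleftrightarrow> (\<forall>x\<in>verts G. \<forall>y\<in>verts G. reachable G x y)"

definition component_of :: "'a ugraph \<Rightarrow> 'a \<Rightarrow> 'a ugraph" where
  "component_of G x =
     (let C = {y \<in> verts G. reachable G x y}
      in \<lparr>verts = C, edges = {e \<in> edges G. e \<subseteq> C}\<rparr>)"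

definition graph_components :: "'a ugraph \<Rightarrow> 'a ugraph set" where
  "graph_components G = component_of G ` verts G"

definition edges_between :: "'a ugraph \<Rightarrow> 'a set \<Rightarrow> 'a set \<Rightarrow> 'a set set" where
  "edges_between G A B = {{y, z} | y z. {y, z} \<in> edges G \<and> y \<in> A \<and> z \<in> B}"

definition TI :: "'a ugraph \<Rightarrow> bool" where
  "TI G \<longleftrightarrow>
     (\<forall>A B. A \<subseteq> verts G \<and> B \<subseteq> verts G \<and> verts G = A \<union> B \<and> A \<inter> B = {} \<and>
            infinite A \<and> infinite B \<longrightarrow> infinite (edges_between G A B))"

definition percolating_everywhere :: "'a ugraph \<Rightarrow> 'a ugraph \<Rightarrow> bool" where
  "percolating_everywhere G H \<longleftrightarrow>
     subgraph H G \<and> verts H = verts G \<and> (\<forall>C\<in>graph_components H. infinite (verts C))"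

text \<open>A configuration assigns to every edge the value \<^term>\<open>True\<close> (open) or
  \<^term>\<open>False\<close> (closed).\<close>

definition bernoulli_percolation :: "'a ugraph \<Rightarrow> real \<Rightarrow> ('a set \<Rightarrow> bool) measure" where
  "bernoulli_percolation G p = (\<Pi>\<^sub>M e\<in>edges G. measure_pmf (bernoulli_pmf p))"

definition open_subgraph :: "'a ugraph \<Rightarrow> ('a set \<Rightarrow> bool) \<Rightarrow> 'a ugraph" where
  "open_subgraph G \<omega> = \<lparr>verts = verts G, edges = {e \<in> edges G. \<omega> e}\<rparr>"

definition open_cluster :: "'a ugraph \<Rightarrow> ('a set \<Rightarrow> bool) \<Rightarrow> 'a \<Rightarrow> 'a ugraph" where
  "open_cluster G \<omega> x = component_of (open_subgraph G \<omega>) x"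

text \<open>The parameter \<open>p\<close> enters the random subgraph only through the law of the
  configuration \<open>\<omega>\<close>.\<close>

definition enlargement :: "'a ugraph \<Rightarrow> ('a set \<Rightarrow> bool) \<Rightarrow> 'a ugraph \<Rightarrow> 'a ugraph" where
  "enlargement G \<omega> H =
     \<lparr>verts = (\<Union>x\<in>verts H. verts (open_cluster G \<omega> x)),
      edges = edges H \<union> (\<Union>x\<in>verts H. edges (open_cluster G \<omega> x))\<rparr>"

definition enlargement_prob ::
    "'a ugraph \<Rightarrow> 'a ugraph \<Rightarrow> ('a ugraph \<Rightarrow> bool) \<Rightarrow> real \<Rightarrow> real" where
  "enlargement_prob G H P p =
     measure (bernoulli_percolation G p)
       {\<omega> \<in> space (bernoulli_percolation G p). P (enlargement G \<omega> H)}"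

text \<open>The infima are taken in the reals, so they are meaningful only for nonempty sets.
  When \<open>G\<close> is connected, \<open>H\<close> spans \<open>G\<close> and the property is connectedness, both sets
  contain \<open>1\<close>.\<close>

definition p_c1 :: "'a ugraph \<Rightarrow> 'a ugraph \<Rightarrow> ('a ugraph \<Rightarrow> bool) \<Rightarrow> real" where
  "p_c1 G H P = Inf {p \<in> {0..1}. enlargement_prob G H P p > 0}"

definition p_c2 :: "'a ugraph \<Rightarrow> 'a ugraph \<Rightarrow> ('a ugraph \<Rightarrow> bool) \<Rightarrow> real" where
  "p_c2 G H P = Inf {p \<in> {0..1}. enlargement_prob G H P p = 1}"

end

theory Submission
  imports Defs
begin

text \<open>
  When \<open>H\<close> spans \<open>G\<close>, the enlargement of \<open>H\<close> is simply \<open>H\<close> together with all open edges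
  (\<open>enlargement_spanning\<close>), so the question is whether adding independently chosen edges to
  \<open>H\<close> makes it connected.

  Under (TI), suppose that the enlargement is connected with positive probability at some \<open>p\<close>.
  The event that it has only finitely many components is then of positive probability. This
  event does not change when finitely many edges are closed or opened, because closing one edge
  splits at most one component in two, so it has probability one
  (\<open>finitely_connects_zero_one\<close>). For \<open>p' > p\<close>, percolation at \<open>p'\<close> is the union of
  percolation at \<open>p\<close> and an independent percolation at some \<open>q > 0\<close>
  (\<open>bernoulli_percolation_sprinkle\<close>). Given the first one, finitely many infinite components
  are left. There are finitely many ways to split them in two groups, (TI) puts infinitely many
  edges across each such split, and almost surely one of these edges is opened by the second
  percolation (\<open>TI_AE_sprinkling_connects\<close>). Hence the enlargement at \<open>p'\<close> is almost surely
  connected, and the two critical values agree. If \<open>H\<close> itself has finitely many components, the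
  same argument starts from \<open>p = 0\<close> and gives connectedness at every \<open>p' > 0\<close>.

  If (TI) fails, some bipartition of the vertices into two infinite sets has a finite cut. In a
  bipartition whose cut has the least number of edges both sides are connected: if one side fell
  apart, moving a piece of it to the other side would save edges
  (\<open>minimal_cut_side_connected\<close>). Deleting these \<open>m > 0\<close> edges leaves a graph \<open>H\<close> with
  two infinite components, and its enlargement is connected precisely when one of the deleted
  edges is open. The probability \<open>1 - (1 - p)\<^sup>m\<close> is positive for \<open>p > 0\<close> and less than one
  for \<open>p < 1\<close>.
\<close>

section \<open>Linking by edge sets\<close>

abbreviation linked :: "'a set set \<Rightarrow> 'a \<Rightarrow> 'a \<Rightarrow> bool" where
  "linked F \<equiv> (\<lambda>x y. {x, y} \<in> F)\<^sup>*\<^sup>*"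

definition connects :: "'a set set \<Rightarrow> 'a set \<Rightarrow> bool" where
  "connects F V \<longleftrightarrow> (\<forall>x\<in>V. \<forall>y\<in>V. linked F x y)"

text \<open>Having finitely many components is expressed by a finite set of vertices that meets all
  of them. Such a set is easy to repair when edges are removed, and only countably many candidates
  for it exist, which makes the corresponding event measurable.\<close>

definition finitely_connects :: "'a set set \<Rightarrow> 'a set \<Rightarrow> bool" where
  "finitely_connects F V \<longleftrightarrow> (\<exists>S. finite S \<and> S \<subseteq> V \<and> (\<forall>y\<in>V. \<exists>x\<in>S. linked F x y))"

lemma linked_sym: "linked F x y \<Longrightarrow> linked F y x"
  by (rule sympD[OF symp_rtranclp]) (auto simp: symp_def insert_commute)

lemma linked_mono: "linked F x y \<Longrightarrow> F \<subseteq> F' \<Longrightarrow> linked F' x y"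
  by (erule rtranclp_mono[THEN predicate2D, rotated]) auto

lemma linked_within:
  assumes "linked F x y" "x \<in> V" "\<And>u v. {u, v} \<in> F \<Longrightarrow> u \<in> V \<Longrightarrow> v \<in> V"
  shows "y \<in> V"
  using assms(1,2) by (induction rule: rtranclp_induct) (auto dest: assms(3))

text \<open>Connectedness is used and refuted through cuts, not through explicit paths.\<close>

lemma connects_crossing:
  assumes "connects F V" "A \<subseteq> V" "A \<noteq> {}" "A \<noteq> V"
  obtains u v where "{u, v} \<in> F" "u \<in> A" "v \<notin> A"
proof -
  from assms obtain x y where "x \<in> A" "y \<in> V" "y \<notin> A" "linked F x y"
    unfolding connects_def by blast
  then show ?thesis
    using that linked_within[of F x y A] by blast
qed

lemma finitely_connects_if_connects:
  assumes "connects F V"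
  shows "finitely_connects F V"
proof (cases "V = {}")
  case True
  then show ?thesis by (auto simp: finitely_connects_def)
next
  case False
  then obtain x where "x \<in> V" by auto
  then show ?thesis
    using assms unfolding finitely_connects_def connects_def
    by (intro exI[of _ "{x}"]) auto
qed

text \<open>A path in \<open>F\<close> that starts at a representative, cut after its last edge in \<open>J\<close>, is a
  path in \<open>F'\<close> that starts at an endpoint of an edge in \<open>J\<close>. So adding these endpoints to the
  representatives is enough.\<close>

lemma finitely_connects_remove_finite:
  assumes "finitely_connects F V" "F \<subseteq> F' \<union> J" "finite J" "\<And>e. e \<in> J \<Longrightarrow> finite e \<and> e \<subseteq> V"
  shows "finitely_connects F' V"
proof -
  obtain S where S: "finite S" "S \<subseteq> V" "\<And>y. y \<in> V \<Longrightarrow> \<exists>x\<in>S. linked F x y"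
    using assms(1) unfolding finitely_connects_def by blast
  have "\<exists>x'\<in>S \<union> \<Union>J. linked F' x' y" if "linked F x y" "x \<in> S" for x y
    using that(1)
  proof (induction rule: rtranclp_induct)
    case base
    then show ?case using that(2) by blast
  next
    case (step y z)
    then have "{y, z} \<in> F' \<or> {y, z} \<in> J" using assms(2) by blast
    then show ?case
    proof
      assume "{y, z} \<in> F'"
      with step.IH show ?thesis by (meson rtranclp.rtrancl_into_rtrancl)
    next
      assume "{y, z} \<in> J"
      then have "z \<in> \<Union>J" by blast
      then show ?thesis by blast
    qed
  qed
  then show ?thesis
    using S assms(3,4) unfolding finitely_connects_def
    by (intro exI[of _ "S \<union> \<Union>J"]) blast
qed

section \<open>The enlargement of a spanning subgraph\<close>

definition enlarged_edges :: "'a ugraph \<Rightarrow> 'a ugraph \<Rightarrow> ('a set \<Rightarrow> bool) \<Rightarrow> 'a set set" where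
  "enlarged_edges G H \<omega> = edges H \<union> {e \<in> edges G. \<omega> e}"

lemma reachable_iff_linked: "reachable G = linked (edges G)"
  by (simp add: reachable_def)

lemma simple_graph_edgeD:
  assumes "simple_graph G" "{x, y} \<in> edges G"
  shows "x \<in> verts G" "y \<in> verts G"
  using assms by (auto simp: simple_graph_def)

text \<open>Every vertex of \<open>G\<close> is a vertex of \<open>H\<close>, so every open edge lies in the cluster of a
  vertex of \<open>H\<close>, namely of one of its own endpoints.\<close>

lemma enlargement_spanning:
  assumes "simple_graph G" "verts H = verts G"
  shows "enlargement G \<omega> H = \<lparr>verts = verts G, edges = enlarged_edges G H \<omega>\<rparr>"
proof -
  let ?O = "open_subgraph G \<omega>"
  have V: "(\<Union>x\<in>verts G. verts (open_cluster G \<omega> x)) = verts G"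
    by (auto simp: open_cluster_def component_of_def open_subgraph_def reachable_def Let_def)
  have "e \<in> edges (open_cluster G \<omega> x)" if e: "e \<in> edges G" "\<omega> e" "x \<in> e" for e x
  proof -
    have "e \<subseteq> verts G" "card e = 2"
      using assms(1) e(1) by (auto simp: simple_graph_def)
    then obtain a b where ab: "e = {a, b}" by (meson card_2_iff)
    then have "{x, y} = e" if "y \<in> e" "y \<noteq> x" for y
      using e(3) that by auto
    then have "reachable ?O x y" if "y \<in> e" for y
      using that e by (cases "y = x") (auto simp: open_subgraph_def reachable_def)
    with \<open>e \<subseteq> verts G\<close> e show ?thesis
      by (auto simp: open_cluster_def component_of_def open_subgraph_def Let_def)
  qed
  moreover have "\<exists>x\<in>verts G. x \<in> e" if "e \<in> edges G" for e
    using assms(1) that by (fastforce simp: simple_graph_def card_2_iff)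
  ultimately have E: "(\<Union>x\<in>verts G. edges (open_cluster G \<omega> x)) = {e \<in> edges G. \<omega> e}"
    by (fastforce simp: open_cluster_def component_of_def open_subgraph_def Let_def)
  show ?thesis
    by (simp add: enlargement_def enlarged_edges_def assms(2) V E)
qed

lemma connected_enlargement_iff:
  assumes "simple_graph G" "verts H = verts G"
  shows "connected_graph (enlargement G \<omega> H) \<longleftrightarrow> connects (enlarged_edges G H \<omega>) (verts G)"
  by (simp add: enlargement_spanning[OF assms] connected_graph_def connects_def
      reachable_iff_linked)

lemma percolating_everywhereD:
  assumes "percolating_everywhere G H"
  shows "verts H = verts G" "edges H \<subseteq> edges G"
    and "x \<in> verts G \<Longrightarrow> infinite {y \<in> verts G. linked (edges H) x y}"
  using assms
  by (auto simp: percolating_everywhere_def subgraph_def graph_components_def component_of_def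
      reachable_iff_linked Let_def)

lemma finite_components_imp_finitely_connects:
  assumes "finite (graph_components H)"
  shows "finitely_connects (edges H) (verts H)"
proof -
  obtain S where S: "finite S" "S \<subseteq> verts H" "component_of H ` S = graph_components H"
    using assms finite_subset_image[of "graph_components H" "component_of H" "verts H"]
    unfolding graph_components_def by (metis order_refl)
  have "\<exists>x\<in>S. linked (edges H) x y" if "y \<in> verts H" for y
  proof -
    have "component_of H y \<in> component_of H ` S"
      using that S(3) by (auto simp: graph_components_def)
    then obtain x where x: "x \<in> S" "component_of H y = component_of H x" by auto
    have "y \<in> verts (component_of H y)"
      using that by (simp add: component_of_def reachable_def Let_def)
    then have "y \<in> verts (component_of H x)"
      by (simp add: x(2))
    with x(1) show ?thesis
      by (auto simp: component_of_def reachable_iff_linked Let_def)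
  qed
  with S(1,2) show ?thesis unfolding finitely_connects_def by (intro exI[of _ S]) simp
qed

text \<open>All vertices are reached from one of them, and each vertex has finitely many
  neighbours. Countability turns the connection events into measurable sets.\<close>

lemma countable_verts_if_connected_locally_finite:
  assumes "simple_graph G" "locally_finite_graph G" "connected_graph G"
  shows "countable (verts G)"
proof (cases "verts G = {}")
  case False
  then obtain x where x: "x \<in> verts G" by auto
  let ?R = "\<lambda>x y. {x, y} \<in> edges G"
  have nb: "countable {z. {y, z} \<in> edges G}" for y
  proof (cases "y \<in> verts G")
    case True
    then have "finite {e \<in> edges G. y \<in> e}"
      using assms(2) by (simp add: locally_finite_graph_def)
    moreover have "finite e" if "e \<in> edges G" for e
      using assms(1) that by (auto simp: simple_graph_def intro: card_ge_0_finite)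
    ultimately have "finite (\<Union>{e \<in> edges G. y \<in> e})" by auto
    then have "finite {z. {y, z} \<in> edges G}"
      by (rule rev_finite_subset) auto
    then show ?thesis by (rule countable_finite)
  next
    case False
    then have "{z. {y, z} \<in> edges G} = {}"
      using simple_graph_edgeD[OF assms(1)] by auto
    then show ?thesis by simp
  qed
  have "countable {y. (?R ^^ n) x y}" for n
  proof (induction n)
    case (Suc n)
    have "{y. (?R ^^ Suc n) x y} = (\<Union>y\<in>{y. (?R ^^ n) x y}. {z. {y, z} \<in> edges G})"
      by auto
    with Suc nb show ?case by simp
  qed simp
  moreover have "verts G \<subseteq> (\<Union>n. {y. (?R ^^ n) x y})"
    using assms(3) x
    by (auto simp: connected_graph_def reachable_def rtranclp_power)
  ultimately show ?thesis
    by (meson countable_UN countable_subset countableI_type)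
qed simp

section \<open>Bond percolation as a product measure\<close>

lemma prob_space_bernoulli_percolation: "prob_space (bernoulli_percolation G p)"
  unfolding bernoulli_percolation_def by (intro prob_space_PiM prob_space_measure_pmf)

lemma sets_bernoulli_percolation:
  "sets (bernoulli_percolation G p) = sets (PiM (edges G) (\<lambda>_. count_space UNIV))"
  unfolding bernoulli_percolation_def by (intro sets_PiM_cong) auto

lemma space_bernoulli_percolation:
  "space (bernoulli_percolation G p) = PiE (edges G) (\<lambda>_. UNIV)"
  by (simp add: bernoulli_percolation_def space_PiM)

lemma measurable_edge_state [measurable]:
  "e \<in> edges G \<Longrightarrow> Measurable.pred (bernoulli_percolation G p) (\<lambda>\<omega>. \<omega> e)"
  using measurable_component_singleton[of e "edges G" "\<lambda>_. count_space UNIV"]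
  by (simp add: measurable_cong_sets[OF sets_bernoulli_percolation refl])

lemma measure_all_closed:
  assumes "finite J" "J \<subseteq> edges G" "0 \<le> p" "p \<le> 1"
  shows "measure (bernoulli_percolation G p)
    {\<omega> \<in> space (bernoulli_percolation G p). \<forall>e\<in>J. \<not> \<omega> e} = (1 - p) ^ card J"
proof -
  interpret product_prob_space "\<lambda>_. measure_pmf (bernoulli_pmf p)" "edges G"
    by standard
  show ?thesis
    using emeasure_PiM_Collect[of J "\<lambda>_. {False}"] assms
    by (simp add: bernoulli_percolation_def emeasure_pmf_single ennreal_power measure_def)
qed

text \<open>For every \<open>n\<close>, the set contains \<open>n\<close> edges, which are all closed with probability
  \<open>(1 - p)\<^sup>n\<close>.\<close>

lemma AE_open_edge_in_infinite_set:
  assumes D: "infinite D" "D \<subseteq> edges G" and p: "0 < p" "p \<le> 1" and cnt: "countable (edges G)"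
  shows "AE \<omega> in bernoulli_percolation G p. \<exists>e\<in>D. \<omega> e"
proof -
  let ?M = "bernoulli_percolation G p"
  interpret prob_space ?M by (rule prob_space_bernoulli_percolation)
  have [measurable]: "countable D" using D(2) cnt countable_subset by blast
  have [measurable]: "Measurable.pred ?M (\<lambda>\<omega>. \<omega> e)" if "e \<in> D" for e
    using that D(2) by (intro measurable_edge_state) auto
  let ?N = "{\<omega> \<in> space ?M. \<forall>e\<in>D. \<not> \<omega> e}"
  have N: "?N \<in> sets ?M" by measurable
  have "prob ?N \<le> (1 - p) ^ n" for n
  proof -
    obtain J where J: "finite J" "card J = n" "J \<subseteq> D"
      using infinite_arbitrarily_large[OF D(1)] by blast
    have [measurable]: "Measurable.pred ?M (\<lambda>\<omega>. \<omega> e)" if "e \<in> J" for e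
      using that D(2) J(3) by (intro measurable_edge_state) auto
    have "prob ?N \<le> prob {\<omega> \<in> space ?M. \<forall>e\<in>J. \<not> \<omega> e}"
      using J by (intro finite_measure_mono) (auto intro: countable_finite)
    also have "\<dots> = (1 - p) ^ n"
      using J D p by (subst measure_all_closed) auto
    finally show ?thesis .
  qed
  moreover have "(\<lambda>n. (1 - p) ^ n) \<longlonglongrightarrow> 0"
    using p by (intro LIMSEQ_realpow_zero) auto
  ultimately have "prob ?N \<le> 0"
    by (intro LIMSEQ_le_const) auto
  then have "prob ?N = 0" by (simp add: measure_le_0_iff)
  then have "?N \<in> null_sets ?M" using N by (simp add: null_sets_def emeasure_eq_measure)
  then show ?thesis by (rule AE_I') auto
qed

text \<open>The law of a configuration is determined by the probabilities that finite sets \<open>J\<close> of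
  edges are closed, since these events form a generator that is stable under intersection. In the
  union of two independent configurations \<open>J\<close> is closed iff it is closed in both, so the
  probabilities \<open>(1 - p)\<close> and \<open>(1 - q)\<close> multiply.\<close>

lemma bernoulli_percolation_sprinkle:
  assumes "0 \<le> p" "p \<le> 1" "0 \<le> q" "q \<le> 1"
  shows "distr (bernoulli_percolation G p \<Otimes>\<^sub>M bernoulli_percolation G q)
      (bernoulli_percolation G (1 - (1 - p) * (1 - q)))
      (\<lambda>(\<omega>, \<eta>). \<lambda>e\<in>edges G. \<omega> e \<or> \<eta> e) = bernoulli_percolation G (1 - (1 - p) * (1 - q))"
proof -
  let ?E = "edges G" and ?r = "1 - (1 - p) * (1 - q)"
  let ?P = "bernoulli_percolation G p" and ?Q = "bernoulli_percolation G q"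
    and ?R = "bernoulli_percolation G ?r"
  let ?f = "\<lambda>(\<omega>, \<eta>). \<lambda>e\<in>?E. \<omega> e \<or> \<eta> e"
  let ?closed = "\<lambda>J. {\<omega> \<in> PiE ?E (\<lambda>_. UNIV). \<forall>e\<in>J. \<not> \<omega> e}"
  define \<G> where "\<G> = {?closed J | J. finite J \<and> J \<subseteq> ?E}"
  interpret P: prob_space ?P by (rule prob_space_bernoulli_percolation)
  interpret Q: prob_space ?Q by (rule prob_space_bernoulli_percolation)
  interpret R: prob_space ?R by (rule prob_space_bernoulli_percolation)
  interpret PQ: pair_prob_space ?P ?Q ..
  have r: "0 \<le> ?r" "?r \<le> 1"
    using assms mult_le_one[of "1 - p" "1 - q"] by auto
  have f: "?f \<in> ?P \<Otimes>\<^sub>M ?Q \<rightarrow>\<^sub>M ?R"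
    unfolding measurable_cong_sets[OF refl sets_bernoulli_percolation] split_beta
    by (intro measurable_restrict) measurable
  have closed_sets: "?closed J \<in> sets (bernoulli_percolation G t)"
    if "finite J" "J \<subseteq> ?E" for J t
  proof -
    have [measurable]: "Measurable.pred (bernoulli_percolation G t) (\<lambda>\<omega>. \<omega> e)" if "e \<in> J" for e
      using that \<open>J \<subseteq> ?E\<close> by (intro measurable_edge_state) auto
    have [measurable]: "countable J" using that(1) by (rule countable_finite)
    have "{\<omega> \<in> space (bernoulli_percolation G t). \<forall>e\<in>J. \<not> \<omega> e}
        \<in> sets (bernoulli_percolation G t)"
      by measurable
    then show ?thesis by (simp only: space_bernoulli_percolation)
  qed
  have gen: "sets (bernoulli_percolation G t) = sigma_sets (PiE ?E (\<lambda>_. UNIV)) \<G>" for t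
  proof
    show "sigma_sets (PiE ?E (\<lambda>_. UNIV)) \<G> \<subseteq> sets (bernoulli_percolation G t)"
      unfolding space_bernoulli_percolation[symmetric, of G t]
      by (intro sets.sigma_sets_subset)
        (auto simp: \<G>_def space_bernoulli_percolation intro!: closed_sets)
  next
    interpret S: sigma_algebra "PiE ?E (\<lambda>_. UNIV)" "sigma_sets (PiE ?E (\<lambda>_. UNIV)) \<G>"
      by (intro sigma_algebra_sigma_sets) (auto simp: \<G>_def)
    have "{f \<in> PiE ?E (\<lambda>_. UNIV). f e \<in> A} \<in> sigma_sets (PiE ?E (\<lambda>_. UNIV)) \<G>"
      if "e \<in> ?E" for e and A :: "bool set"
    proof -
      have "?closed {e} \<in> \<G>" using that by (auto simp: \<G>_def)
      then have c: "?closed {e} \<in> sigma_sets (PiE ?E (\<lambda>_. UNIV)) \<G>" by blast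
      have "A \<in> Pow (UNIV :: bool set)" by simp
      then have "A \<in> Pow {False, True}" by (simp only: UNIV_bool)
      then have "A = {} \<or> A = UNIV \<or> A = {False} \<or> A = {True}"
        by (auto simp: Pow_insert UNIV_bool)
      then consider "A = {}" | "A = UNIV" | "A = {False}" | "A = {True}" by blast
      then show ?thesis
      proof cases
        case 3
        then have "{f \<in> PiE ?E (\<lambda>_. UNIV). f e \<in> A} = ?closed {e}" by auto
        with c show ?thesis by simp
      next
        case 4
        then have "{f \<in> PiE ?E (\<lambda>_. UNIV). f e \<in> A} = PiE ?E (\<lambda>_. UNIV) - ?closed {e}" by auto
        with c S.compl_sets show ?thesis by simp
      qed (auto simp: S.top)
    qed
    then show "sets (bernoulli_percolation G t) \<subseteq> sigma_sets (PiE ?E (\<lambda>_. UNIV)) \<G>"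
      unfolding sets_bernoulli_percolation sets_PiM_single space_count_space
      by (intro S.sigma_sets_subset) auto
  qed
  show ?thesis
  proof (rule measure_eqI_generator_eq[where E = \<G> and \<Omega> = "PiE ?E (\<lambda>_. UNIV)" and A = "\<lambda>_. PiE ?E (\<lambda>_. UNIV)"])
    show "Int_stable \<G>"
    proof (rule Int_stableI)
      fix X Y assume "X \<in> \<G>" "Y \<in> \<G>"
      then obtain J K where "X = ?closed J" "finite J" "J \<subseteq> ?E" "Y = ?closed K" "finite K" "K \<subseteq> ?E"
        by (auto simp: \<G>_def)
      then have "X \<inter> Y = ?closed (J \<union> K)" "finite (J \<union> K)" "J \<union> K \<subseteq> ?E" by auto
      then show "X \<inter> Y \<in> \<G>" unfolding \<G>_def by blast
    qed
    show "\<G> \<subseteq> Pow (PiE ?E (\<lambda>_. UNIV))" by (auto simp: \<G>_def)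
    show "range (\<lambda>_. PiE ?E (\<lambda>_. UNIV)) \<subseteq> \<G>"
      by (auto simp: \<G>_def intro!: exI[of _ "{}"])
    fix X assume "X \<in> \<G>"
    then obtain J where J: "X = ?closed J" "finite J" "J \<subseteq> ?E" by (auto simp: \<G>_def)
    have "?f -` X \<inter> space (?P \<Otimes>\<^sub>M ?Q) = ?closed J \<times> ?closed J"
      using J(3) by (auto simp: J(1) space_pair_measure space_bernoulli_percolation) (metis subsetD)+
    then have "emeasure (distr (?P \<Otimes>\<^sub>M ?Q) ?R ?f) X = emeasure ?P (?closed J) * emeasure ?Q (?closed J)"
      using closed_sets[OF J(2,3)] f
      by (simp add: emeasure_distr J(1) Q.emeasure_pair_measure_Times)
    also have "\<dots> = ennreal ((1 - p) ^ card J) * ennreal ((1 - q) ^ card J)"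
      using measure_all_closed[OF J(2,3)] assms
      by (simp add: P.emeasure_eq_measure Q.emeasure_eq_measure space_bernoulli_percolation)
    also have "\<dots> = ennreal ((1 - ?r) ^ card J)"
      using assms by (simp add: ennreal_mult[symmetric] power_mult_distrib)
    also have "\<dots> = emeasure ?R X"
      using measure_all_closed[OF J(2,3) r]
      by (simp add: R.emeasure_eq_measure space_bernoulli_percolation J(1))
    finally show "emeasure (distr (?P \<Otimes>\<^sub>M ?Q) ?R ?f) X = emeasure ?R X" .
  next
    fix i :: nat
    interpret D: prob_space "distr (?P \<Otimes>\<^sub>M ?Q) ?R ?f"
      by (rule PQ.prob_space_distr[OF f])
    show "emeasure (distr (?P \<Otimes>\<^sub>M ?Q) ?R ?f) (PiE ?E (\<lambda>_. UNIV)) \<noteq> \<infinity>"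
      using D.emeasure_finite by simp
  qed (auto simp: gen)
qed

section \<open>A zero-one law for product measures\<close>

text \<open>Replacing the coordinates in \<open>J\<close> by those of an independent copy does not change a
  product measure, because the coordinates inside and outside \<open>J\<close> are independent.\<close>

lemma PiM_resample:
  assumes "\<And>i. i \<in> I \<Longrightarrow> prob_space (M i)" "J \<subseteq> I"
  shows "distr (PiM I M \<Otimes>\<^sub>M PiM I M) (PiM I M) (\<lambda>(\<omega>, \<omega>'). \<lambda>i\<in>I. if i \<in> J then \<omega> i else \<omega>' i)
    = PiM I M"
proof (rule measure_eqI_PiM_infinite)
  let ?P = "PiM I M" and ?f = "\<lambda>(\<omega>, \<omega>'). \<lambda>i\<in>I. if i \<in> J then \<omega> i else \<omega>' i"
  interpret P: prob_space ?P by (intro prob_space_PiM assms)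
  interpret PP: pair_prob_space ?P ?P ..
  have f: "?f \<in> ?P \<Otimes>\<^sub>M ?P \<rightarrow>\<^sub>M ?P"
    unfolding split_beta by (intro measurable_restrict) auto
  show "finite_measure (distr (?P \<Otimes>\<^sub>M ?P) ?P ?f)"
    using PP.prob_space_distr[OF f] by (rule prob_space.finite_measure)
  fix A K assume K: "finite K" "K \<subseteq> I" and A: "\<And>i. i \<in> K \<Longrightarrow> A i \<in> sets (M i)"
  let ?C = "\<lambda>K. prod_emb I M K (Pi\<^sub>E K A)"
  have C: "?C K' \<in> sets ?P" if "K' \<subseteq> K" for K'
    using that K A finite_subset[OF that] by (intro sets_PiM_I) auto
  have "?f -` ?C K \<inter> space (?P \<Otimes>\<^sub>M ?P) = ?C (K \<inter> J) \<times> ?C (K - J)"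
    using K(2) by (auto simp: space_pair_measure prod_emb_iff space_PiM PiE_iff extensional_def)
      (metis subsetD)+
  then have "emeasure (distr (?P \<Otimes>\<^sub>M ?P) ?P ?f) (?C K) = emeasure ?P (?C (K \<inter> J)) * emeasure ?P (?C (K - J))"
    using C f by (simp add: emeasure_distr P.emeasure_pair_measure_Times)
  also have "\<dots> = (\<Prod>i\<in>K \<inter> J. emeasure (M i) (A i)) * (\<Prod>i\<in>K - J. emeasure (M i) (A i))"
    using K A by (subst (1 2) emeasure_PiM_emb) (auto intro: assms)
  also have "\<dots> = (\<Prod>i\<in>K. emeasure (M i) (A i))"
    using K(1) by (subst prod.Int_Diff[of K _ J]) auto
  also have "\<dots> = emeasure ?P (?C K)"
    using K A by (subst emeasure_PiM_emb) (auto intro: assms)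
  finally show "emeasure (distr (?P \<Otimes>\<^sub>M ?P) ?P ?f) (?C K) = emeasure ?P (?C K)" .
qed auto

text \<open>This is Kolmogorov's zero-one law for arbitrary index sets. Let \<open>C\<close> be a cylinder on a
  finite set \<open>J\<close>. After resampling the coordinates in \<open>J\<close>, membership in \<open>C\<close> depends on the new
  copy only, and membership in the invariant set \<open>T\<close> on the old copy only. So \<open>T\<close> is independent
  of all cylinders, hence of every measurable set, hence of itself.\<close>

lemma PiM_zero_one:
  assumes prob: "\<And>i. i \<in> I \<Longrightarrow> prob_space (M i)" and T: "T \<in> sets (PiM I M)"
    and inv: "\<And>\<omega> \<omega>'. \<omega> \<in> T \<Longrightarrow> \<omega>' \<in> space (PiM I M) \<Longrightarrow> finite {i \<in> I. \<omega> i \<noteq> \<omega>' i} \<Longrightarrow> \<omega>' \<in> T"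
  shows "measure (PiM I M) T = 0 \<or> measure (PiM I M) T = 1"
proof -
  let ?P = "PiM I M"
  interpret P: prob_space ?P by (intro prob_space_PiM prob)
  have "density ?P (indicator T) = scale_measure (emeasure ?P T) ?P"
  proof (rule measure_eqI_PiM_infinite)
    show "finite_measure (density ?P (indicator T))"
      using T by (intro finite_measureI) (simp add: emeasure_density)
    fix A J assume J: "finite J" "J \<subseteq> I" and A: "\<And>i. i \<in> J \<Longrightarrow> A i \<in> sets (M i)"
    let ?C = "prod_emb I M J (Pi\<^sub>E J A)" and ?f = "\<lambda>(\<omega>, \<omega>'). \<lambda>i\<in>I. if i \<in> J then \<omega> i else \<omega>' i"
    have C: "?C \<in> sets ?P" using J A by (intro sets_PiM_I) auto
    have f: "?f \<in> ?P \<Otimes>\<^sub>M ?P \<rightarrow>\<^sub>M ?P"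
      unfolding split_beta by (intro measurable_restrict) auto
    have fT: "?f (\<omega>, \<omega>') \<in> T \<longleftrightarrow> \<omega>' \<in> T" if "\<omega> \<in> space ?P" "\<omega>' \<in> space ?P" for \<omega> \<omega>'
    proof -
      have "?f (\<omega>, \<omega>') \<in> space ?P" using that by (auto simp: space_PiM PiE_iff)
      moreover have "finite {i \<in> I. ?f (\<omega>, \<omega>') i \<noteq> \<omega>' i}" "finite {i \<in> I. \<omega>' i \<noteq> ?f (\<omega>, \<omega>') i}"
        by (auto intro!: finite_subset[OF _ J(1)] split: if_splits)
      ultimately show ?thesis using that inv by blast
    qed
    have fC: "?f (\<omega>, \<omega>') \<in> ?C \<longleftrightarrow> \<omega> \<in> ?C" if "\<omega> \<in> space ?P" "\<omega>' \<in> space ?P" for \<omega> \<omega>'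
      using that J(2) by (auto simp: prod_emb_iff space_PiM PiE_iff extensional_def subset_eq)
    have TS: "T \<subseteq> space ?P" "?C \<subseteq> space ?P" using T C sets.sets_into_space by blast+
    have "emeasure ?P (?C \<inter> T) = emeasure (distr (?P \<Otimes>\<^sub>M ?P) ?P ?f) (?C \<inter> T)"
      using PiM_resample[OF prob J(2)] by simp
    also have "\<dots> = emeasure (?P \<Otimes>\<^sub>M ?P) (?f -` (?C \<inter> T) \<inter> space (?P \<Otimes>\<^sub>M ?P))"
      using f C T by (intro emeasure_distr) auto
    also have "?f -` (?C \<inter> T) \<inter> space (?P \<Otimes>\<^sub>M ?P) = ?C \<times> T"
    proof -
      have "z \<in> ?f -` (?C \<inter> T) \<inter> space (?P \<Otimes>\<^sub>M ?P) \<longleftrightarrow> z \<in> ?C \<times> T" for z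
      proof (cases z)
        case (Pair \<omega> \<omega>')
        show ?thesis
          using fT[of \<omega> \<omega>'] fC[of \<omega> \<omega>'] TS unfolding Pair space_pair_measure by blast
      qed
      then show ?thesis by blast
    qed
    also have "emeasure (?P \<Otimes>\<^sub>M ?P) (?C \<times> T) = emeasure ?P ?C * emeasure ?P T"
      using C T by (rule P.emeasure_pair_measure_Times)
    finally show "emeasure (density ?P (indicator T)) ?C = emeasure (scale_measure (emeasure ?P T) ?P) ?C"
      using C T by (simp add: emeasure_density indicator_inter_arith[symmetric] Int_commute mult.commute)
  qed auto
  then have "emeasure (density ?P (indicator T)) T = emeasure ?P T * emeasure ?P T"
    by (simp)
  then have "emeasure ?P T = emeasure ?P T * emeasure ?P T"
    using T by (simp add: emeasure_density indicator_inter_arith[symmetric])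
  then have "measure ?P T = measure ?P T * measure ?P T"
    by (simp add: P.emeasure_eq_measure ennreal_mult[symmetric] ennreal_inj)
  then show ?thesis by auto
qed

section \<open>Measurability of the connection events\<close>

text \<open>Measurability is proved for a random edge set \<open>F\<close> on an arbitrary space, because it is
  needed for one configuration as well as for a pair of them.\<close>

lemma pred_linked:
  assumes cnt: "countable V" and F: "\<And>e. Measurable.pred M (\<lambda>\<omega>. e \<in> F \<omega>)"
    and V: "\<And>\<omega> u v. {u, v} \<in> F \<omega> \<Longrightarrow> u \<in> V"
  shows "Measurable.pred M (\<lambda>\<omega>. linked (F \<omega>) x y)"
proof -
  have [measurable]: "countable V" by (rule cnt)
  have "Measurable.pred M (\<lambda>\<omega>. ((\<lambda>u v. {u, v} \<in> F \<omega>) ^^ n) x y)" for n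
  proof (induction n arbitrary: y)
    case (Suc n)
    have step: "((\<lambda>u v. {u, v} \<in> F \<omega>) ^^ Suc n) x y \<longleftrightarrow>
        (\<exists>z\<in>V. ((\<lambda>u v. {u, v} \<in> F \<omega>) ^^ n) x z \<and> {z, y} \<in> F \<omega>)" for \<omega>
      using V by (auto simp: relcompp_apply)
    note [measurable] = Suc F
    show ?case unfolding step by measurable
  qed simp
  note [measurable] = this
  show ?thesis unfolding rtranclp_power by measurable
qed

lemma pred_connects:
  assumes "countable V" "\<And>e. Measurable.pred M (\<lambda>\<omega>. e \<in> F \<omega>)"
    "\<And>\<omega> u v. {u, v} \<in> F \<omega> \<Longrightarrow> u \<in> V"
  shows "Measurable.pred M (\<lambda>\<omega>. connects (F \<omega>) V)"
proof -
  note [measurable] = pred_linked[OF assms] assms(1)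
  show ?thesis unfolding connects_def by measurable
qed

lemma pred_finitely_connects:
  assumes "countable V" "\<And>e. Measurable.pred M (\<lambda>\<omega>. e \<in> F \<omega>)"
    "\<And>\<omega> u v. {u, v} \<in> F \<omega> \<Longrightarrow> u \<in> V"
  shows "Measurable.pred M (\<lambda>\<omega>. finitely_connects (F \<omega>) V)"
proof -
  have "countable {S. finite S \<and> S \<subseteq> V}"
    using assms(1) by (rule countable_Collect_finite_subset)
  moreover have "Measurable.pred M (\<lambda>\<omega>. \<forall>y\<in>V. \<exists>x\<in>S. linked (F \<omega>) x y)" if "finite S" for S
  proof -
    note [measurable] = pred_linked[OF assms] assms(1) countable_finite[OF that]
    show ?thesis by measurable
  qed
  ultimately have "Measurable.pred M
      (\<lambda>\<omega>. \<exists>S\<in>{S. finite S \<and> S \<subseteq> V}. \<forall>y\<in>V. \<exists>x\<in>S. linked (F \<omega>) x y)"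
    by (intro measurable_pred_countable(2)) auto
  moreover have "finitely_connects (F \<omega>) V \<longleftrightarrow>
      (\<exists>S\<in>{S. finite S \<and> S \<subseteq> V}. \<forall>y\<in>V. \<exists>x\<in>S. linked (F \<omega>) x y)" for \<omega>
    by (auto simp: finitely_connects_def)
  ultimately show ?thesis by simp
qed

lemma pred_enlarged_edges:
  assumes "\<And>e. e \<in> edges G \<Longrightarrow> Measurable.pred M (\<lambda>\<omega>. f \<omega> e)"
  shows "Measurable.pred M (\<lambda>\<omega>. e \<in> enlarged_edges G H (f \<omega>))"
  using assms[of e] by (cases "e \<in> edges G") (auto simp: enlarged_edges_def)

lemma enlarged_edges_subset:
  "edges H \<subseteq> edges G \<Longrightarrow> enlarged_edges G H \<omega> \<subseteq> edges G"
  by (auto simp: enlarged_edges_def)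

section \<open>Infinite cuts and sprinkling\<close>

lemma edges_between_commute: "edges_between G A B = edges_between G B A"
  unfolding edges_between_def by (metis (lifting) insert_commute)

lemma edges_between_subset: "edges_between G A B \<subseteq> edges G"
  by (auto simp: edges_between_def)

lemma countable_edges:
  assumes "simple_graph G" "countable (verts G)"
  shows "countable (edges G)"
proof (rule countable_subset)
  show "edges G \<subseteq> {e. finite e \<and> e \<subseteq> verts G}"
    using assms(1) by (auto simp: simple_graph_def intro: card_ge_0_finite)
qed (rule countable_Collect_finite_subset[OF assms(2)])

text \<open>Each component of \<open>F\<close> is infinite and there are finitely many of them, represented by
  \<open>S\<close>. A set of vertices that is closed under \<open>F\<close> is a union of components, so it is determined
  by its intersection \<open>T\<close> with \<open>S\<close>. Thus only finitely many cuts have to be crossed by an open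
  edge, and by (TI) each of them is crossed by infinitely many edges.\<close>

lemma TI_AE_sprinkling_connects:
  assumes G: "simple_graph G" "countable (verts G)" "TI G" and F: "F \<subseteq> edges G"
    and inf: "\<And>x. x \<in> verts G \<Longrightarrow> infinite {y \<in> verts G. linked F x y}"
    and fin: "finitely_connects F (verts G)" and q: "0 < q" "q \<le> 1"
  shows "AE \<eta> in bernoulli_percolation G q. connects (F \<union> {e \<in> edges G. \<eta> e}) (verts G)"
proof -
  let ?V = "verts G" and ?M = "bernoulli_percolation G q"
  obtain S where S: "finite S" "S \<subseteq> ?V" "\<And>y. y \<in> ?V \<Longrightarrow> \<exists>x\<in>S. linked F x y"
    using fin unfolding finitely_connects_def by blast
  define comps where "comps T = {y \<in> ?V. \<exists>x\<in>T. linked F x y}" for T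
  let ?D = "\<lambda>T. edges_between G (comps T) (?V - comps T)"
  have "AE \<eta> in ?M. \<forall>T\<in>Pow S. infinite (?D T) \<longrightarrow> (\<exists>e\<in>?D T. \<eta> e)"
  proof (rule AE_finite_allI)
    fix T show "AE \<eta> in ?M. infinite (?D T) \<longrightarrow> (\<exists>e\<in>?D T. \<eta> e)"
      using AE_open_edge_in_infinite_set[OF _ edges_between_subset q countable_edges[OF G(1,2)]]
      by (cases "finite (?D T)") auto
  qed (use S(1) in simp)
  then show ?thesis
  proof eventually_elim
    case (elim \<eta>)
    let ?F = "F \<union> {e \<in> edges G. \<eta> e}"
    show ?case
    proof (rule ccontr)
      assume "\<not> connects ?F ?V"
      then obtain x y where xy: "x \<in> ?V" "y \<in> ?V" "\<not> linked ?F x y"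
        by (auto simp: connects_def)
      \<comment> \<open>The component of \<open>x\<close> after sprinkling is a union of components of \<open>F\<close>, and so is its
        complement. This is a cut that no open edge crosses.\<close>
      define A where "A = {z \<in> ?V. linked ?F x z}"
      have FA: "z' \<in> A" if "z \<in> A" "linked F z z'" "z' \<in> ?V" for z z'
      proof -
        have "linked ?F z z'" using that(2) by (rule linked_mono) auto
        with that(1,3) show ?thesis by (auto simp: A_def)
      qed
      have A: "A = comps (S \<inter> A)"
      proof
        show "A \<subseteq> comps (S \<inter> A)"
        proof
          fix z assume z: "z \<in> A"
          then obtain s where "s \<in> S" "linked F s z" using S(3) by (auto simp: A_def)
          moreover have "s \<in> A" using S(2) \<open>s \<in> S\<close> FA[OF z linked_sym[OF \<open>linked F s z\<close>]] by blast
          ultimately show "z \<in> comps (S \<inter> A)" using z by (auto simp: comps_def A_def)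
        qed
      qed (use FA in \<open>auto simp: comps_def\<close>)
      have "{z \<in> ?V. linked F x z} \<subseteq> A"
        using FA[of x] xy(1) by (auto simp: A_def)
      then have "infinite A" using inf[OF xy(1)] finite_subset by blast
      moreover have "{z \<in> ?V. linked F y z} \<subseteq> ?V - A"
        using FA[of _ y] xy by (auto simp: A_def dest: linked_sym)
      then have "infinite (?V - A)" using inf[OF xy(2)] finite_subset by blast
      moreover have "A \<subseteq> ?V" by (auto simp: A_def)
      ultimately have "infinite (edges_between G A (?V - A))"
        using G(3) unfolding TI_def by (elim allE[of _ A] allE[of _ "?V - A"]) auto
      moreover have "infinite (?D (S \<inter> A)) \<longrightarrow> (\<exists>e\<in>?D (S \<inter> A). \<eta> e)"
        using elim by blast
      ultimately obtain e where "e \<in> edges_between G A (?V - A)" "\<eta> e"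
        unfolding A[symmetric] by blast
      then obtain u v where uv: "{u, v} \<in> edges G" "\<eta> {u, v}" "u \<in> A" "v \<in> ?V - A"
        by (auto simp: edges_between_def)
      then have "linked ?F u v" by (intro r_into_rtranclp) auto
      moreover have "linked ?F x u" using uv(3) unfolding A_def by blast
      ultimately have "linked ?F x v" by (rule rtranclp_trans[rotated])
      with uv(4) show False unfolding A_def by blast
    qed
  qed
qed

section \<open>Enlargements under (TI)\<close>

lemma enlargement_prob_connected:
  assumes "simple_graph G" "verts H = verts G"
  shows "enlargement_prob G H connected_graph p = measure (bernoulli_percolation G p)
    {\<omega> \<in> space (bernoulli_percolation G p). connects (enlarged_edges G H \<omega>) (verts G)}"
  by (simp add: enlargement_prob_def connected_enlargement_iff[OF assms])

lemma enlargement_prob_eq_1_iff: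
  assumes "simple_graph G" "countable (verts G)" "verts H = verts G" "edges H \<subseteq> edges G"
  shows "enlargement_prob G H connected_graph p = 1 \<longleftrightarrow>
    (AE \<omega> in bernoulli_percolation G p. connects (enlarged_edges G H \<omega>) (verts G))"
proof -
  interpret prob_space "bernoulli_percolation G p" by (rule prob_space_bernoulli_percolation)
  have "Measurable.pred (bernoulli_percolation G p) (\<lambda>\<omega>. connects (enlarged_edges G H \<omega>) (verts G))"
    using enlarged_edges_subset[OF assms(4)] simple_graph_edgeD[OF assms(1)]
    by (intro pred_connects assms pred_enlarged_edges measurable_edge_state) blast+
  then show ?thesis
    unfolding enlargement_prob_connected[OF assms(1,3)] by (intro prob_Collect_eq_1) (auto simp: pred_def)
qed

text \<open>Connectedness itself is not invariant under finite modifications, since closing a single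
  edge can destroy it. Finiteness of the number of components is the weaker property that
  survives.\<close>

lemma finitely_connects_zero_one:
  assumes G: "simple_graph G" "countable (verts G)" and H: "edges H \<subseteq> edges G"
    and M: "M = bernoulli_percolation G p"
  shows "measure M {\<omega> \<in> space M. finitely_connects (enlarged_edges G H \<omega>) (verts G)} = 0 \<or>
    (AE \<omega> in M. finitely_connects (enlarged_edges G H \<omega>) (verts G))"
proof -
  let ?T = "{\<omega> \<in> space M. finitely_connects (enlarged_edges G H \<omega>) (verts G)}"
  interpret prob_space M unfolding M by (rule prob_space_bernoulli_percolation)
  have "Measurable.pred M (\<lambda>\<omega>. finitely_connects (enlarged_edges G H \<omega>) (verts G))"
    unfolding M using enlarged_edges_subset[OF H] simple_graph_edgeD[OF G(1)]
    by (intro pred_finitely_connects G pred_enlarged_edges measurable_edge_state) blast+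
  then have T: "?T \<in> sets M" by (simp add: pred_def)
  have "measure M ?T = 0 \<or> measure M ?T = 1"
    using T unfolding M bernoulli_percolation_def
  proof (intro PiM_zero_one prob_space_measure_pmf)
    fix \<omega> \<omega>' assume \<omega>: "\<omega> \<in> {\<omega> \<in> space (PiM (edges G) (\<lambda>e. measure_pmf (bernoulli_pmf p))).
        finitely_connects (enlarged_edges G H \<omega>) (verts G)}"
      and \<omega>': "\<omega>' \<in> space (PiM (edges G) (\<lambda>e. measure_pmf (bernoulli_pmf p)))"
      and J: "finite {e \<in> edges G. \<omega> e \<noteq> \<omega>' e}"
    have "finitely_connects (enlarged_edges G H \<omega>') (verts G)"
    proof (rule finitely_connects_remove_finite[OF _ _ J])
      show "finitely_connects (enlarged_edges G H \<omega>) (verts G)" using \<omega> by simp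
      show "finite e \<and> e \<subseteq> verts G" if "e \<in> {e \<in> edges G. \<omega> e \<noteq> \<omega>' e}" for e
        using that G(1) by (auto simp: simple_graph_def intro: card_ge_0_finite)
    qed (auto simp: enlarged_edges_def)
    with \<omega>' show "\<omega>' \<in> {\<omega> \<in> space (PiM (edges G) (\<lambda>e. measure_pmf (bernoulli_pmf p))).
        finitely_connects (enlarged_edges G H \<omega>) (verts G)}" by simp
  qed auto
  then show ?thesis using prob_Collect_eq_1[OF T] by blast
qed

text \<open>The parameter \<open>q\<close> of the second percolation solves \<open>1 - p' = (1 - p) (1 - q)\<close>. By Fubini's
  theorem the first configuration can be kept fixed while the second one joins its components.\<close>

lemma TI_sprinkling:
  assumes G: "simple_graph G" "countable (verts G)" "TI G" and H: "percolating_everywhere G H"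
    and p: "0 \<le> p" "p < p'" "p' \<le> 1"
    and fin: "AE \<omega> in bernoulli_percolation G p. finitely_connects (enlarged_edges G H \<omega>) (verts G)"
  shows "enlargement_prob G H connected_graph p' = 1"
proof -
  note H' = percolating_everywhereD[OF H]
  define q where "q = (p' - p) / (1 - p)"
  have q: "0 < q" "q \<le> 1" and pq: "1 - (1 - p) * (1 - q) = p'"
    using p by (auto simp: q_def field_simps)
  let ?P = "bernoulli_percolation G p" and ?Q = "bernoulli_percolation G q"
    and ?R = "bernoulli_percolation G p'" and ?V = "verts G"
  let ?f = "\<lambda>(\<omega>, \<eta>). \<lambda>e\<in>edges G. \<omega> e \<or> \<eta> e"
  interpret P: prob_space ?P by (rule prob_space_bernoulli_percolation)
  interpret Q: prob_space ?Q by (rule prob_space_bernoulli_percolation)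
  interpret PQ: pair_prob_space ?P ?Q ..
  let ?c = "\<lambda>\<omega>. connects (enlarged_edges G H \<omega>) ?V"
  have conn: "Measurable.pred M (\<lambda>z. ?c (g z))"
    if "\<And>e. e \<in> edges G \<Longrightarrow> Measurable.pred M (\<lambda>z. g z e)" for M :: "'b measure" and g
    using enlarged_edges_subset[OF H'(2)] simple_graph_edgeD[OF G(1)] that
    by (intro pred_connects G pred_enlarged_edges) blast+
  have f: "?f \<in> ?P \<Otimes>\<^sub>M ?Q \<rightarrow>\<^sub>M ?R"
    unfolding measurable_cong_sets[OF refl sets_bernoulli_percolation] split_beta
    by (intro measurable_restrict) measurable
  have "AE z in ?P \<Otimes>\<^sub>M ?Q. ?c (?f z)"
  proof (rule PQ.AE_pair_measure)
    have "Measurable.pred (?P \<Otimes>\<^sub>M ?Q) (\<lambda>z. ?c (?f z))"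
      by (intro conn) (auto simp: split_beta, measurable)
    then show "{z \<in> space (?P \<Otimes>\<^sub>M ?Q). ?c (?f z)} \<in> sets (?P \<Otimes>\<^sub>M ?Q)"
      by (simp add: pred_def)
    show "AE \<omega> in ?P. AE \<eta> in ?Q. ?c (?f (\<omega>, \<eta>))"
      using fin
    proof eventually_elim
      case (elim \<omega>)
      have "infinite {y \<in> ?V. linked (enlarged_edges G H \<omega>) x y}" if "x \<in> ?V" for x
      proof
        assume "finite {y \<in> ?V. linked (enlarged_edges G H \<omega>) x y}"
        moreover have sub: "edges H \<subseteq> enlarged_edges G H \<omega>" by (simp add: enlarged_edges_def)
        have "{y \<in> ?V. linked (edges H) x y} \<subseteq> {y \<in> ?V. linked (enlarged_edges G H \<omega>) x y}"
          by (rule Collect_mono) (use linked_mono[OF _ sub] in simp)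
        ultimately show False using H'(3)[OF that] finite_subset by blast
      qed
      then have "AE \<eta> in ?Q. connects (enlarged_edges G H \<omega> \<union> {e \<in> edges G. \<eta> e}) ?V"
        using elim by (intro TI_AE_sprinkling_connects G q enlarged_edges_subset H')
      moreover have "enlarged_edges G H \<omega> \<union> {e \<in> edges G. \<eta> e} = enlarged_edges G H (?f (\<omega>, \<eta>))" for \<eta>
        by (auto simp: enlarged_edges_def)
      ultimately show ?case by simp
    qed
  qed
  moreover have "Measurable.pred ?R ?c" by (intro conn measurable_edge_state)
  then have "{\<omega> \<in> space ?R. ?c \<omega>} \<in> sets ?R" by (simp add: pred_def)
  ultimately have "AE \<omega> in distr (?P \<Otimes>\<^sub>M ?Q) ?R ?f. ?c \<omega>"
    using f by (subst AE_distr_iff) auto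
  moreover have "distr (?P \<Otimes>\<^sub>M ?Q) ?R ?f = ?R"
    using bernoulli_percolation_sprinkle[of p q G] p q unfolding pq by simp
  ultimately have "AE \<omega> in ?R. ?c \<omega>" by (simp only:)
  then show ?thesis by (simp add: enlargement_prob_eq_1_iff[OF G(1,2) H'(1,2)])
qed

lemma enlargement_prob_at_1:
  assumes G: "simple_graph G" "countable (verts G)" "connected_graph G"
    and H: "verts H = verts G" "edges H \<subseteq> edges G"
  shows "enlargement_prob G H connected_graph 1 = 1"
proof -
  interpret product_prob_space "\<lambda>_. measure_pmf (bernoulli_pmf 1)" "edges G"
    by standard
  have "AE \<omega> in bernoulli_percolation G 1. \<forall>e\<in>edges G. \<omega> e"
  proof (subst AE_ball_countable[OF countable_edges[OF G(1,2)]], intro ballI)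
    fix e assume "e \<in> edges G"
    moreover have "b" if "b \<in> set_pmf (bernoulli_pmf 1)" for b
      using that by (cases b) (auto simp: set_pmf_iff)
    ultimately show "AE \<omega> in bernoulli_percolation G 1. \<omega> e"
      unfolding bernoulli_percolation_def
      by (intro AE_component) (auto simp: AE_measure_pmf_iff)
  qed
  then have "AE \<omega> in bernoulli_percolation G 1. connects (enlarged_edges G H \<omega>) (verts G)"
  proof eventually_elim
    case (elim \<omega>)
    then have "enlarged_edges G H \<omega> = edges G"
      using H by (auto simp: enlarged_edges_def)
    then show ?case
      using G(3) by (simp add: connected_graph_def connects_def reachable_iff_linked)
  qed
  then show ?thesis by (simp add: enlargement_prob_eq_1_iff[OF G(1,2) H])
qed

lemma TI_critical_values:
  assumes G: "simple_graph G" "countable (verts G)" "connected_graph G" "TI G"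
    and H: "percolating_everywhere G H"
  shows "p_c1 G H connected_graph = p_c2 G H connected_graph"
    and "finite (graph_components H) \<Longrightarrow> p_c2 G H connected_graph = 0"
proof -
  note H' = percolating_everywhereD[OF H]
  let ?P = "enlargement_prob G H connected_graph"
  define S1 where "S1 = {p \<in> {0..1}. ?P p > 0}"
  define S2 where "S2 = {p \<in> {0..1}. ?P p = 1}"
  have 1: "1 \<in> S2" using enlargement_prob_at_1[OF G(1-3) H'(1,2)] by (simp add: S2_def)
  have sub: "S2 \<subseteq> S1" by (auto simp: S1_def S2_def)
  have bdd: "bdd_below S1" "bdd_below S2" unfolding S1_def S2_def by (auto intro!: bdd_belowI[of _ 0])
  \<comment> \<open>Positive probability at \<open>p\<close> becomes probability one at every larger parameter.\<close>
  have up: "p' \<in> S2" if "p \<in> S1" "p < p'" "p' \<le> 1" for p p'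
  proof -
    let ?M = "bernoulli_percolation G p"
    let ?T = "{\<omega> \<in> space ?M. finitely_connects (enlarged_edges G H \<omega>) (verts G)}"
    interpret prob_space ?M by (rule prob_space_bernoulli_percolation)
    have "Measurable.pred ?M (\<lambda>\<omega>. finitely_connects (enlarged_edges G H \<omega>) (verts G))"
      using enlarged_edges_subset[OF H'(2)] simple_graph_edgeD[OF G(1)]
      by (intro pred_finitely_connects G pred_enlarged_edges measurable_edge_state) blast+
    then have "?T \<in> sets ?M" by (simp add: pred_def)
    then have "?P p \<le> prob ?T"
      unfolding enlargement_prob_connected[OF G(1) H'(1)]
      by (intro finite_measure_mono) (auto intro: finitely_connects_if_connects)
    moreover have "?P p > 0" using that(1) by (simp add: S1_def)
    ultimately have "prob ?T \<noteq> 0" by simp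
    then have "AE \<omega> in ?M. finitely_connects (enlarged_edges G H \<omega>) (verts G)"
      using finitely_connects_zero_one[OF G(1,2) H'(2)] by blast
    then have "?P p' = 1"
      using that by (intro TI_sprinkling[OF G(1,2,4) H]) (auto simp: S1_def)
    then show ?thesis using that by (auto simp: S1_def S2_def)
  qed
  have "Inf S1 \<le> Inf S2" using 1 sub bdd by (intro cInf_superset_mono) auto
  moreover have "Inf S2 \<le> Inf S1"
  proof (rule cInf_greatest)
    show "S1 \<noteq> {}" using 1 sub by auto
    fix p assume p: "p \<in> S1"
    then have "p \<le> 1" by (simp add: S1_def)
    then consider "p = 1" | "p < 1" by linarith
    then show "Inf S2 \<le> p"
    proof cases
      case 1
      with \<open>1 \<in> S2\<close> bdd show ?thesis by (auto intro: cInf_lower)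
    next
      case 2
      then show ?thesis
      proof (rule dense_ge_bounded)
        fix w assume "p < w" "w < 1"
        then show "Inf S2 \<le> w" using up[OF p] bdd by (intro cInf_lower) auto
      qed
    qed
  qed
  ultimately show "p_c1 G H connected_graph = p_c2 G H connected_graph"
    by (simp add: p_c1_def p_c2_def S1_def S2_def)
  assume "finite (graph_components H)"
  then have "finitely_connects (edges H) (verts G)"
    using finite_components_imp_finitely_connects H'(1) by metis
  then have "finitely_connects (enlarged_edges G H \<omega>) (verts G)" for \<omega>
    by (rule finitely_connects_remove_finite[of _ _ _ "{}"]) (auto simp: enlarged_edges_def)
  then have small: "p \<in> S2" if "0 < p" "p \<le> 1" for p
    using TI_sprinkling[OF G(1,2,4) H, of 0 p] that by (simp add: S2_def)
  have "Inf S2 \<le> 0"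
  proof (rule dense_ge_bounded[of 0 1])
    fix w :: real assume "0 < w" "w < 1"
    then show "Inf S2 \<le> w" using small bdd by (intro cInf_lower) auto
  qed simp
  moreover have "0 \<le> Inf S2" using 1 by (intro cInf_greatest) (auto simp: S2_def)
  ultimately show "p_c2 G H connected_graph = 0"
    by (simp add: p_c2_def S2_def)
qed

section \<open>Minimal finite cuts and the failure of (TI)\<close>

definition infinite_bipartition :: "'a set \<Rightarrow> 'a set \<Rightarrow> 'a set \<Rightarrow> bool" where
  "infinite_bipartition V A B \<longleftrightarrow> A \<union> B = V \<and> A \<inter> B = {} \<and> infinite A \<and> infinite B"

text \<open>Suppose that \<open>A\<close> splits into parts \<open>C\<close> and \<open>D\<close> without edges between them, and let \<open>C\<close> be
  an infinite one. Moving \<open>D\<close> to the other side creates no new crossing edges, but the edges from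
  \<open>D\<close> to \<open>B\<close>, of which there is at least one as \<open>G\<close> is connected, no longer cross. This
  contradicts minimality. The two parts play
  symmetric roles, so at least one of them can serve as \<open>C\<close>.\<close>

lemma minimal_cut_side_connected:
  assumes conn: "connected_graph G" and simple: "simple_graph G"
    and AB: "infinite_bipartition (verts G) A B" "finite (edges_between G A B)"
    and min: "\<And>A' B'. infinite_bipartition (verts G) A' B' \<Longrightarrow> finite (edges_between G A' B') \<Longrightarrow>
      card (edges_between G A B) \<le> card (edges_between G A' B')"
  shows "connects (edges G - edges_between G A B) A"
proof (rule ccontr)
  let ?V = "verts G" and ?cut = "edges_between G A B"
  let ?F = "edges G - ?cut"
  note ab = AB(1)[unfolded infinite_bipartition_def]
  have no_split: False if CD: "C \<union> D = A" "C \<inter> D = {}" "infinite C" "D \<noteq> {}"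
    and no: "\<And>u v. {u, v} \<in> edges G \<Longrightarrow> u \<in> C \<Longrightarrow> v \<notin> D" for C D
  proof -
    have sub: "edges_between G C (?V - C) \<subseteq> ?cut"
    proof
      fix e assume "e \<in> edges_between G C (?V - C)"
      then obtain u v where uv: "e = {u, v}" "{u, v} \<in> edges G" "u \<in> C" "v \<in> ?V - C"
        by (auto simp: edges_between_def)
      moreover from this have "v \<in> B" "u \<in> A" using no[of u v] CD(1) ab by auto
      ultimately show "e \<in> ?cut" unfolding edges_between_def by blast
    qed
    have "connects (edges G) ?V"
      using conn by (simp add: connected_graph_def connects_def reachable_iff_linked)
    moreover have "C \<noteq> {}" using CD(3) by auto
    then have "D \<subseteq> ?V" "D \<noteq> ?V" using CD ab by blast+
    ultimately obtain u v where uv: "{u, v} \<in> edges G" "u \<in> D" "v \<notin> D"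
      using connects_crossing CD(4) by metis
    have "v \<notin> C" using no[of v u] uv by (auto simp: insert_commute)
    moreover have "v \<in> ?V" using simple_graph_edgeD[OF simple uv(1)] by blast
    ultimately have "v \<in> B" using uv CD(1) ab by blast
    then have "{u, v} \<in> ?cut" using uv CD(1) unfolding edges_between_def by blast
    moreover have "{u, v} \<notin> edges_between G C (?V - C)"
      using \<open>v \<notin> C\<close> uv(2) CD(2) by (auto simp: edges_between_def doubleton_eq_iff)
    ultimately have "edges_between G C (?V - C) \<subset> ?cut" using sub by blast
    then have "card (edges_between G C (?V - C)) < card ?cut"
      using AB(2) by (intro psubset_card_mono)
    moreover have "infinite_bipartition ?V C (?V - C)"
    proof -
      have "B \<subseteq> ?V - C" using CD(1) ab by blast
      then have "infinite (?V - C)" using ab finite_subset by blast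
      then show ?thesis using CD ab by (auto simp: infinite_bipartition_def)
    qed
    ultimately show False
      using min[of C "?V - C"] finite_subset[OF sub AB(2)] by simp
  qed
  assume "\<not> connects ?F A"
  then obtain x y where xy: "x \<in> A" "y \<in> A" "\<not> linked ?F x y"
    by (auto simp: connects_def)
  define C where "C = {z \<in> A. linked ?F x z}"
  define D where "D = A - C"
  have CD: "C \<union> D = A" "C \<inter> D = {}" by (auto simp: C_def D_def)
  have ne: "x \<in> C" "y \<in> D" using xy by (auto simp: C_def D_def)
  have no: "v \<notin> D" if "{u, v} \<in> edges G" "u \<in> C" for u v
  proof
    assume "v \<in> D"
    then have v: "v \<in> A" "v \<notin> C" by (auto simp: D_def)
    have "{u, v} \<notin> ?cut"
      using v(1) that(2) ab by (auto simp: edges_between_def doubleton_eq_iff C_def)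
    then have "{u, v} \<in> ?F" using that by blast
    moreover have "linked ?F x u" using that by (simp add: C_def)
    ultimately have "linked ?F x v" by (rule rtranclp.rtrancl_into_rtrancl[rotated])
    with v show False by (simp add: C_def)
  qed
  have no': "v \<notin> C" if "{u, v} \<in> edges G" "u \<in> D" for u v
    using no[of v u] that by (auto simp: insert_commute)
  have "infinite C \<or> infinite D" using ab CD(1) by (metis finite_Un)
  then show False
  proof
    assume "infinite C"
    then show False using ne(2) by (intro no_split[OF CD _ _ no]) auto
  next
    assume "infinite D"
    then show False using ne(1) CD by (intro no_split[of D C, OF _ _ _ _ no']) auto
  qed
qed

lemma not_TI_minimal_cut:
  assumes "connected_graph G" "simple_graph G" "\<not> TI G"
  obtains A B where "infinite_bipartition (verts G) A B" "finite (edges_between G A B)"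
    "connects (edges G - edges_between G A B) A" "connects (edges G - edges_between G A B) B"
proof -
  let ?ok = "\<lambda>(A, B). infinite_bipartition (verts G) A B \<and> finite (edges_between G A B)"
  let ?card = "\<lambda>(A, B). card (edges_between G A B)"
  obtain A0 B0 where "?ok (A0, B0)"
    using assms(3) by (auto simp: TI_def infinite_bipartition_def)
  then obtain AB where AB: "?ok AB" "\<And>AB'. ?ok AB' \<Longrightarrow> ?card AB \<le> ?card AB'"
    using ex_has_least_nat[of ?ok "(A0, B0)" ?card] by blast
  obtain A B where [simp]: "AB = (A, B)" by (cases AB)
  have ok: "infinite_bipartition (verts G) A B" "finite (edges_between G A B)"
    and min: "\<And>A' B'. infinite_bipartition (verts G) A' B' \<Longrightarrow> finite (edges_between G A' B') \<Longrightarrow>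
      card (edges_between G A B) \<le> card (edges_between G A' B')"
    using AB(1) AB(2)[of "(A', B')" for A' B'] by auto
  have sym: "infinite_bipartition (verts G) B A"
    using ok(1) by (auto simp: infinite_bipartition_def)
  show ?thesis
  proof (rule that[OF ok])
    show "connects (edges G - edges_between G A B) A"
      by (rule minimal_cut_side_connected[OF assms(1,2) ok min])
    show "connects (edges G - edges_between G A B) B"
      using minimal_cut_side_connected[OF assms(1,2) sym] ok(2) min
      by (simp add: edges_between_commute[of G B A])
  qed
qed

lemma not_TI_critical_values:
  assumes G: "simple_graph G" "connected_graph G" and nTI: "\<not> TI G"
  shows "\<exists>H. percolating_everywhere G H \<and>
    p_c1 G H connected_graph = 0 \<and> p_c2 G H connected_graph = 1"
proof -
  let ?V = "verts G"
  obtain A B where AB: "infinite_bipartition ?V A B" "finite (edges_between G A B)"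
    and conn: "connects (edges G - edges_between G A B) A" "connects (edges G - edges_between G A B) B"
    by (rule not_TI_minimal_cut[OF G(2,1) nTI])
  note ab = AB(1)[unfolded infinite_bipartition_def]
  define cut where "cut = edges_between G A B"
  define m where "m = card cut"
  define H where "H = \<lparr>verts = ?V, edges = edges G - cut\<rparr>"
  note conn = conn[folded cut_def]
  have cut_edge: "{u, v} \<in> cut" if "{u, v} \<in> edges G" "u \<in> A" "v \<notin> A" for u v
    using that simple_graph_edgeD[OF G(1) that(1)] ab unfolding cut_def edges_between_def by blast
  have "A \<noteq> {}" "B \<noteq> {}" using ab by auto
  then have A: "A \<subseteq> ?V" "A \<noteq> {}" "A \<noteq> ?V" using ab by blast+
  have "connects (edges G) ?V"
    using G(2) by (simp add: connected_graph_def connects_def reachable_iff_linked)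
  then have "cut \<noteq> {}" using connects_crossing[OF _ A] cut_edge by blast
  then have m: "m > 0" using AB(2) by (simp add: m_def cut_def card_gt_0_iff)
  have perc: "percolating_everywhere G H"
  proof -
    have "infinite {y \<in> ?V. linked (edges G - cut) x y}" if "x \<in> ?V" for x
    proof
      assume fin: "finite {y \<in> ?V. linked (edges G - cut) x y}"
      have "A \<subseteq> {y \<in> ?V. linked (edges G - cut) x y} \<or> B \<subseteq> {y \<in> ?V. linked (edges G - cut) x y}"
        using conn that ab by (auto simp: connects_def)
      then show False using fin ab finite_subset by blast
    qed
    moreover have "simple_graph H" using G(1) by (auto simp: simple_graph_def H_def)
    ultimately show ?thesis
      by (auto simp: percolating_everywhere_def subgraph_def graph_components_def component_of_def
          reachable_iff_linked Let_def H_def)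
  qed
  \<comment> \<open>The two sides are connected in \<open>H\<close>, so a single open edge of the cut joins everything.\<close>
  have iff: "connects (enlarged_edges G H \<omega>) ?V \<longleftrightarrow> (\<exists>e\<in>cut. \<omega> e)" for \<omega>
  proof
    assume "connects (enlarged_edges G H \<omega>) ?V"
    then obtain u v where uv: "{u, v} \<in> enlarged_edges G H \<omega>" "u \<in> A" "v \<notin> A"
      using connects_crossing A by metis
    then have "{u, v} \<in> cut" by (intro cut_edge) (auto simp: enlarged_edges_def H_def)
    with uv(1) show "\<exists>e\<in>cut. \<omega> e" by (auto simp: enlarged_edges_def H_def)
  next
    assume "\<exists>e\<in>cut. \<omega> e"
    then obtain u v where uv: "{u, v} \<in> edges G" "\<omega> {u, v}" "u \<in> A" "v \<in> B"
      by (auto simp: cut_def edges_between_def)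
    let ?F = "enlarged_edges G H \<omega>"
    have sub: "edges G - cut \<subseteq> ?F" by (auto simp: enlarged_edges_def H_def)
    have "linked ?F u v" using uv by (intro r_into_rtranclp) (auto simp: enlarged_edges_def)
    have "linked ?F u x" if "x \<in> ?V" for x
    proof (cases "x \<in> A")
      case True
      with conn(1) uv(3) show ?thesis by (auto simp: connects_def intro: linked_mono[OF _ sub])
    next
      case False
      with that ab have "x \<in> B" by blast
      with conn(2) uv(4) have "linked ?F v x"
        by (auto simp: connects_def intro: linked_mono[OF _ sub])
      with \<open>linked ?F u v\<close> show ?thesis by (rule rtranclp_trans)
    qed
    then show "connects ?F ?V"
      unfolding connects_def by (intro ballI) (rule rtranclp_trans[OF linked_sym[of _ u]])
  qed
  have prob: "enlargement_prob G H connected_graph p = 1 - (1 - p) ^ m" if p: "0 \<le> p" "p \<le> 1" for p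
  proof -
    let ?M = "bernoulli_percolation G p"
    interpret prob_space ?M by (rule prob_space_bernoulli_percolation)
    let ?N = "{\<omega> \<in> space ?M. \<forall>e\<in>cut. \<not> \<omega> e}"
    have cut: "finite cut" "cut \<subseteq> edges G" using AB(2) edges_between_subset by (auto simp: cut_def)
    have [measurable]: "Measurable.pred ?M (\<lambda>\<omega>. \<omega> e)" if "e \<in> cut" for e
      using that cut(2) by (intro measurable_edge_state) auto
    have [measurable]: "countable cut" using cut(1) by (rule countable_finite)
    have "?N \<in> sets ?M" by measurable
    then have "prob (space ?M - ?N) = 1 - (1 - p) ^ m"
      using measure_all_closed[OF cut p] by (simp add: prob_compl m_def)
    moreover have "{\<omega> \<in> space ?M. connects (enlarged_edges G H \<omega>) ?V} = space ?M - ?N"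
      by (auto simp: iff)
    ultimately show ?thesis
      by (simp add: enlargement_prob_connected[OF G(1)] H_def)
  qed
  have "{p \<in> {0..1}. enlargement_prob G H connected_graph p > 0} = {0<..1}"
  proof (intro set_eqI iffI)
    fix p assume "p \<in> {p \<in> {0..1}. enlargement_prob G H connected_graph p > 0}"
    then show "p \<in> {0<..1}" using m by (cases "p = 0") (auto simp: prob)
  next
    fix p :: real assume "p \<in> {0<..1}"
    then show "p \<in> {p \<in> {0..1}. enlargement_prob G H connected_graph p > 0}"
      using m by (auto simp: prob power_less_one_iff)
  qed
  moreover have "{p \<in> {0..1}. enlargement_prob G H connected_graph p = 1} = {1}"
    using m by (auto simp: prob)
  ultimately show ?thesis
    using perc by (intro exI[of _ H]) (simp add: p_c1_def p_c2_def)
qed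

section \<open>Connectedness of the enlargement and (TI)\<close>

theorem theorem1p13:
  fixes G :: "'a ugraph"
  assumes "simple_graph G" and "locally_finite_graph G"
    and "infinite (verts G)" and "connected_graph G"
  shows "(TI G \<longrightarrow>
      (\<forall>H. percolating_everywhere G H \<longrightarrow>
        p_c1 G H connected_graph = p_c2 G H connected_graph \<and>
        (finite (graph_components H) \<longrightarrow>
          p_c1 G H connected_graph = 0 \<and> p_c2 G H connected_graph = 0))) \<and>
    (\<not> TI G \<longrightarrow>
      (\<exists>H. percolating_everywhere G H \<and>
        p_c1 G H connected_graph = 0 \<and> p_c2 G H connected_graph = 1))"
proof -
  have "countable (verts G)"
    using assms(1,2,4) by (rule countable_verts_if_connected_locally_finite)
  then show ?thesis
    using TI_critical_values[OF assms(1) _ assms(4)] not_TI_critical_values[OF assms(1,4)] by auto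
qed

end
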